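(* Let $\mathbb{D}$ be a division ring with finite dimension $d$ over a central subfield $\mathbb{F}$, and let $n\geq 1$ be such that $|\mathbb{F}|\geq nd$. Then the greatest possible dimension (over $\mathbb{F}$) of a unital $\mathbb{F}$-affine subspace of $\mathrm{M}_n(\mathbb{D})$ is $n(d-1)+d\binom{n}{2}$.
   Context: A central subfield of $\mathbb{D}$ is a subfield contained in the center of $\mathbb{D}$. A subset of $\mathrm{M}_n(\mathbb{D})$ is called unital if all its elements are invertible, i.e. it is contained in $\mathrm{GL}_n(\mathbb{D})$. *)

theory Defs
  imports "HOL-Analysis.Analysis"
begin

definition central_subfield :: "'a::division_ring set \<Rightarrow> bool" where
  "central_subfield F \<longleftrightarrow>
     0 \<in> F \<and> 1 \<in> F \<and>
     (\<forall>x\<in>F. \<forall>y\<in>F. x - y \<in> F \<and> x * y \<in> F) \<and>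
     (\<forall>x\<in>F. inverse x \<in> F) \<and>
     (\<forall>x\<in>F. \<forall>y. x * y = y * x)"

text \<open>
  The library's linear algebra over a field (\<open>module\<close>, \<open>vector_space\<close>) takes the scalars from a
  type of class \<open>field\<close>. A central subfield \<open>F\<close> of \<open>'a\<close> is therefore given together with
  an isomorphism \<open>\<iota>\<close> from a field type \<open>'f\<close> onto it; all scalar multiplications below are
  multiplications by the element \<open>\<iota> c\<close> of \<open>F\<close>.
\<close>

locale central_subfield_iso =
  fixes F :: "'a::division_ring set" and \<iota> :: "'f::field \<Rightarrow> 'a"
  assumes central_subfield: "central_subfield F"
    and bij: "bij_betw \<iota> UNIV F"
    and hom_add: "\<iota> (x + y) = \<iota> x + \<iota> y"
    and hom_mult: "\<iota> (x * y) = \<iota> x * \<iota> y"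
    and hom_one: "\<iota> 1 = 1"

definition ring_scale :: "('f::field \<Rightarrow> 'a::division_ring) \<Rightarrow> 'f \<Rightarrow> 'a \<Rightarrow> 'a" where
  "ring_scale \<iota> c x = \<iota> c * x"

definition mat_scale ::
    "('f::field \<Rightarrow> 'a::division_ring) \<Rightarrow> 'f \<Rightarrow> 'a^'n^'n \<Rightarrow> 'a^'n^'n" where
  "mat_scale \<iota> c A = (\<chi> i j. \<iota> c * A $ i $ j)"

definition affine_subspace :: "('f::field \<Rightarrow> 'v::ab_group_add \<Rightarrow> 'v) \<Rightarrow> 'v set \<Rightarrow> bool" where
  "affine_subspace s S \<longleftrightarrow> (\<exists>a V. module.subspace s V \<and> S = (\<lambda>v. a + v) ` V)"

text \<open>The set of differences of an affine subspace \<open>a + V\<close> is its translation space \<open>V\<close>.\<close>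

definition affine_dim :: "('f::field \<Rightarrow> 'v::ab_group_add \<Rightarrow> 'v) \<Rightarrow> 'v set \<Rightarrow> nat" where
  "affine_dim s S = vector_space.dim s {x - y | x y. x \<in> S \<and> y \<in> S}"

definition unital :: "('a::division_ring^'n^'n) set \<Rightarrow> bool" where
  "unital S \<longleftrightarrow> (\<forall>A\<in>S. invertible A)"

text \<open>
  The junk value \<open>0\<close> of \<open>dim\<close> on infinite-dimensional spaces is excluded here by the explicit
  finite spanning set.
\<close>

definition finite_dimension :: "('f::field \<Rightarrow> 'v::ab_group_add \<Rightarrow> 'v) \<Rightarrow> nat \<Rightarrow> bool" where
  "finite_dimension s d \<longleftrightarrow>
     (\<exists>B. finite B \<and> module.span s B = UNIV) \<and> vector_space.dim s UNIV = d"

context central_subfield_iso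
begin

lemma central: "\<iota> c * x = x * \<iota> c"
proof -
  have "\<iota> c \<in> F"
    using bij by (rule bij_betw_apply) simp
  then show ?thesis
    using central_subfield unfolding central_subfield_def by blast
qed

lemma vector_space_ring_scale: "vector_space (ring_scale \<iota>)"
  by unfold_locales
    (simp_all add: ring_scale_def hom_add hom_mult hom_one distrib_left distrib_right mult.assoc)

lemma vector_space_mat_scale:
  "vector_space (mat_scale \<iota> :: 'f \<Rightarrow> 'a^'n^'n \<Rightarrow> 'a^'n^'n)"
  by unfold_locales
    (simp_all add: mat_scale_def vec_eq_iff hom_add hom_mult hom_one distrib_left distrib_right
      mult.assoc)

lemma affine_dim_translate:
  assumes "module.subspace (mat_scale \<iota>) (V :: ('a^'n^'n) set)"
  shows "affine_dim (mat_scale \<iota>) ((\<lambda>v. a + v) ` V) = vector_space.dim (mat_scale \<iota>) V"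
proof -
  interpret vector_space "mat_scale \<iota> :: 'f \<Rightarrow> 'a^'n^'n \<Rightarrow> 'a^'n^'n"
    by (rule vector_space_mat_scale)
  let ?S = "(\<lambda>v. a + v) ` V"
  have "x - y \<in> V" if "x \<in> ?S" "y \<in> ?S" for x y
    using that subspace_diff[OF assms] by auto
  moreover have "\<exists>x y. v = x - y \<and> x \<in> ?S \<and> y \<in> ?S" if "v \<in> V" for v
    using that subspace_0[OF assms] by (intro exI[of _ "a + v"] exI[of _ "a + 0"]) simp
  ultimately have "{x - y | x y. x \<in> ?S \<and> y \<in> ?S} = V"
    by blast
  then show ?thesis by (simp add: affine_dim_def)
qed

end

end

theory Submission
  imports Defs
begin

text \<open>
  Multiplying by the inverse of one of its elements, a unital affine subspace becomes \<open>1 + V\<close>, where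
  no matrix in \<open>V\<close> has a nonzero eigenvalue in \<open>F\<close>. For a column \<open>x\<close>, let \<open>\<Phi>\<^sub>x\<close> send a row \<open>r\<close> to the pair
  \<open>(x r mod V, r x)\<close>. If no \<open>\<Phi>\<^sub>x\<close> were injective, take \<open>x\<close> with \<open>\<Phi>\<^sub>x\<close> of maximal rank, \<open>r \<noteq> 0\<close> in its
  kernel, and \<open>y\<close> with \<open>r y = 1\<close>. Maximality of the rank and \<open>|F| \<ge> n d\<close> force \<open>\<Phi>\<^sub>y r = \<Phi>\<^sub>x s\<close> for some \<open>s\<close>,
  that is, \<open>y r - x s \<in> V\<close> and \<open>s x = 1\<close>; but \<open>(y r - x s) x = - x\<close>, a contradiction.

  So some \<open>\<Phi>\<^sub>x\<close> is injective. Then \<open>{A \<in> V. A x = 0}\<close> acts faithfully on the quotient of the column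
  space by \<open>x D\<close>, again without nonzero eigenvalues in \<open>F\<close>, while \<open>V x\<close> does not contain \<open>x\<close> and so has
  dimension at most \<open>n d - 1\<close>. Summing up over \<open>n\<close> gives the bound. It is attained by \<open>1 + V\<close> with \<open>V\<close>
  the upper triangular matrices whose diagonal entries lie in a hyperplane of \<open>D\<close> that avoids \<open>1\<close>.
\<close>

section \<open>Rank-nullity on subspaces and pencils of linear maps\<close>

context finite_dimensional_vector_space_pair
begin

text \<open>Rank-nullity for the restriction of \<open>f\<close> to \<open>V\<close>: a right
  inverse \<open>g\<close> of \<open>f\<close> on the image splits \<open>V\<close> into the kernel
  and a copy \<open>R\<close> of the image.\<close>

lemma dim_kernel_image:
  assumes f: "Vector_Spaces.linear s1 s2 f" and V: "vs1.subspace V"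
  shows "vs1.dim V = vs1.dim {v \<in> V. f v = 0} + vs2.dim (f ` V)"
proof -
  interpret f: Vector_Spaces.linear s1 s2 f by fact
  obtain g where gV: "range g \<subseteq> V" and g: "Vector_Spaces.linear s2 s1 g"
    and fg: "\<forall>w\<in>f ` V. f (g w) = w"
    using linear_exists_right_inverse_on[OF f V] by auto
  interpret g: Vector_Spaces.linear s2 s1 g by fact
  define K where "K = {v \<in> V. f v = 0}"
  define R where "R = g ` f ` V"
  have "vs2.subspace (f ` V)"
    using V by (rule f.subspace_image)
  then have R: "vs1.subspace R"
    unfolding R_def by (rule g.subspace_image)
  have K: "vs1.subspace K"
    using V by (auto simp: K_def vs1.subspace_def f.add f.scale f.zero)
  have inj: "inj_on f (vs1.span R)"
    unfolding vs1.span_eq_iff[THEN iffD2, OF R] using fg by (auto simp: R_def inj_on_def)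
  have "f ` R = f ` V"
    using fg by (force simp: R_def image_image)
  then have dimR: "vs1.dim R = vs2.dim (f ` V)"
    using dim_image_eq[OF f inj] by simp
  have "K \<inter> R \<subseteq> {0}"
    using fg by (auto simp: K_def R_def g.zero)
  then have "vs1.dim (K \<inter> R) = 0"
    by simp
  moreover have "{x + y | x y. x \<in> K \<and> y \<in> R} = V"
  proof (intro set_eqI iffI)
    fix v assume "v \<in> V"
    moreover from this have "v - g (f v) \<in> K"
      using gV fg V by (auto simp: K_def f.diff intro!: vs1.subspace_diff)
    ultimately show "v \<in> {x + y | x y. x \<in> K \<and> y \<in> R}"
      by (intro CollectI exI[of _ "v - g (f v)"] exI[of _ "g (f v)"]) (auto simp: R_def)
  qed (use gV V in \<open>auto simp: K_def R_def intro!: vs1.subspace_add\<close>)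
  ultimately show ?thesis
    using vs1.dim_sums_Int[OF K R] dimR by (simp only: K_def)
qed

lemma exists_kernel_if_dim_image_less:
  assumes f: "Vector_Spaces.linear s1 s2 f" and V: "vs1.subspace V"
    and "vs2.dim (f ` V) < vs1.dim V"
  obtains v where "v \<in> V" "v \<noteq> 0" "f v = 0"
proof -
  have "vs1.dim {v \<in> V. f v = 0} \<noteq> 0"
    using dim_kernel_image[OF f V] assms(3) by linarith
  then have "\<not> {v \<in> V. f v = 0} \<subseteq> {0}"
    by (metis vs1.dim_eq_0)
  then show ?thesis
    using that by blast
qed

text \<open>The pencil version of the independence of eigenvectors for distinct eigenvalues:
  \<open>B + u A\<close> kills \<open>k u\<close>. Computing \<open>B (k u)\<close> in two ways from
  a relation \<open>k u = \<Sum> c x * k x\<close> shows that \<open>A\<close> kills the sum of the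
  \<open>c x * (u - x) * k x\<close>. Injectivity on the span removes \<open>A\<close>, and the
  induction hypothesis makes all coefficients vanish.\<close>

lemma pencil_kernels_independent:
  assumes A: "Vector_Spaces.linear s1 s2 A" and B: "Vector_Spaces.linear s1 s2 B"
    and "finite X"
    and k: "\<And>u. u \<in> X \<Longrightarrow> k u \<noteq> 0 \<and> B (k u) = - s2 u (A (k u))"
    and inj: "\<And>v. v \<in> vs1.span (k ` X) \<Longrightarrow> A v = 0 \<Longrightarrow> v = 0"
  shows "inj_on k X \<and> vs1.independent (k ` X)"
  using \<open>finite X\<close> k inj
proof (induction X)
  case (insert u X)
  interpret A: Vector_Spaces.linear s1 s2 A by fact
  interpret B: Vector_Spaces.linear s1 s2 B by fact
  have "vs1.span (k ` X) \<subseteq> vs1.span (k ` insert u X)"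
    by (rule vs1.span_mono) auto
  then have IH: "inj_on k X" "vs1.independent (k ` X)"
    using insert.IH insert.prems by (meson insertI2 subsetD)+
  have "k u \<notin> vs1.span (k ` X)"
  proof
    assume "k u \<in> vs1.span (k ` X)"
    then obtain c where "k u = (\<Sum>v\<in>k ` X. s1 (c v) v)"
      using \<open>finite X\<close> by (auto simp: vs1.span_finite)
    then have ku: "k u = (\<Sum>x\<in>X. s1 (c (k x)) (k x))"
      using IH(1) by (simp add: sum.reindex)
    have "B (k u) = (\<Sum>x\<in>X. s2 (c (k x)) (- s2 x (A (k x))))"
      using insert.prems(1) by (simp add: ku B.sum B.scale)
    moreover have "B (k u) = - s2 u (\<Sum>x\<in>X. s2 (c (k x)) (A (k x)))"
      using insert.prems(1)[of u] arg_cong[OF ku, of A] by (simp add: A.sum A.scale)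
    ultimately have "(\<Sum>x\<in>X. s2 (c (k x) * (u - x)) (A (k x))) = 0"
      by (simp add: vs2.scale_sum_right sum_negf sum_subtractf vs2.scale_left_diff_distrib
          left_diff_distrib right_diff_distrib mult.commute)
    then have "A (\<Sum>x\<in>X. s1 (c (k x) * (u - x)) (k x)) = 0"
      by (simp add: A.sum A.scale)
    moreover have "(\<Sum>x\<in>X. s1 (c (k x) * (u - x)) (k x)) \<in> vs1.span (k ` insert u X)"
      by (intro vs1.span_sum vs1.span_scale vs1.span_base) auto
    ultimately have "(\<Sum>x\<in>X. s1 (c (k x) * (u - x)) (k x)) = 0"
      using insert.prems(2) by blast
    \<comment> \<open>Independence is about coefficients indexed by vectors, so
      \<open>inv_into X k\<close> recovers each scalar from its vector.\<close>
    then have "(\<Sum>v\<in>k ` X. s1 (c v * (u - inv_into X k v)) v) = 0"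
      using IH(1) by (simp add: sum.reindex)
    then have "\<forall>v\<in>k ` X. c v * (u - inv_into X k v) = 0"
      using vs1.independentD[OF IH(2) _ order_refl,
          where u = "\<lambda>v. c v * (u - inv_into X k v)"] \<open>finite X\<close> by blast
    then have "c (k x) = 0" if "x \<in> X" for x
      using that IH(1) insert.hyps(2) by auto
    then have "k u = 0"
      by (simp add: ku)
    then show False
      using insert.prems(1) by blast
  qed
  then show ?case
    using IH insert.hyps by (auto simp: vs1.independent_insert intro: vs1.span_base)
qed (simp add: vs1.independent_empty)

text \<open>
  Let \<open>U1\<close> be a complement of \<open>ker A\<close> in \<open>U\<close> enlarged by \<open>r\<close>. By maximality of the rank every
  \<open>B + u A\<close> kills some \<open>k u \<noteq> 0\<close> in \<open>U1\<close>, and \<open>B\<close> maps the span of these vectors into \<open>A ` U\<close>.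
  If \<open>A\<close> were injective on that span, the \<open>k u\<close> would be independent and span \<open>U1\<close>, which contains \<open>r\<close>.
  So the span meets \<open>ker A \<inter> U1\<close>, the line through \<open>r\<close>.
\<close>

lemma pencil_maximal_rank:
  assumes A: "Vector_Spaces.linear s1 s2 A" and B: "Vector_Spaces.linear s1 s2 B"
    and U: "vs1.subspace U"
    and max: "\<And>u. vs2.dim ((\<lambda>v. B v + s2 u (A v)) ` U) \<le> vs2.dim (A ` U)"
    and X: "finite (X :: 'a set)" "vs2.dim (A ` U) < card X"
    and r: "r \<in> U" "A r = 0"
  shows "B r \<in> A ` U"
proof (cases "r = 0")
  case True
  interpret B: Vector_Spaces.linear s1 s2 B by fact
  show ?thesis
    using True r B.zero by force
next
  case False
  interpret A: Vector_Spaces.linear s1 s2 A by fact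
  interpret B: Vector_Spaces.linear s1 s2 B by fact
  obtain g where gU: "range g \<subseteq> U" and g: "Vector_Spaces.linear s2 s1 g"
    and Ag: "\<forall>w\<in>A ` U. A (g w) = w"
    using linear_exists_right_inverse_on[OF A U] by auto
  interpret g: Vector_Spaces.linear s2 s1 g by fact
  define R where "R = g ` A ` U"
  have R: "vs1.subspace R"
    unfolding R_def using U by (intro g.subspace_image A.subspace_image)
  have R0: "v = 0" if "v \<in> R" "A v = 0" for v
    using that Ag g.zero by (auto simp: R_def)
  have AR: "A ` R = A ` U"
    using Ag by (force simp: R_def image_image)
  have "inj_on A (vs1.span R)"
    unfolding vs1.span_eq_iff[THEN iffD2, OF R] using Ag by (auto simp: R_def inj_on_def)
  then have dimR: "vs1.dim R = vs2.dim (A ` U)"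
    using dim_image_eq[OF A] AR by metis
  define U1 where "U1 = vs1.span (insert r R)"
  have U1: "vs1.subspace U1"
    by (simp add: U1_def)
  have "U1 \<subseteq> U"
    unfolding U1_def using U r gU by (intro vs1.span_minimal) (auto simp: R_def)
  have "r \<notin> vs1.span R"
    using R0 r False R by (metis vs1.span_eq_iff)
  then have dimU1: "vs1.dim U1 = Suc (vs2.dim (A ` U))"
    by (simp add: U1_def vs1.dim_insert dimR)
  have U1_ker: "\<exists>c. v = s1 c r" if "v \<in> U1" "A v = 0" for v
  proof -
    obtain c where c: "v - s1 c r \<in> R"
      using \<open>v \<in> U1\<close> R unfolding U1_def by (metis vs1.span_breakdown_eq vs1.span_eq_iff)
    moreover have "A (v - s1 c r) = 0"
      using that r by (simp add: A.diff A.scale)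
    ultimately show ?thesis
      using R0 by force
  qed
  have "\<exists>k. k \<in> U1 \<and> k \<noteq> 0 \<and> B k = - s2 u (A k)" for u
  proof -
    have lin: "Vector_Spaces.linear s1 s2 (\<lambda>v. B v + s2 u (A v))"
      by (intro linear_compose_add linear_compose_scale_right A B)
    have "vs2.dim ((\<lambda>v. B v + s2 u (A v)) ` U1) \<le> vs2.dim ((\<lambda>v. B v + s2 u (A v)) ` U)"
      using \<open>U1 \<subseteq> U\<close> by (intro vs2.dim_subset image_mono)
    then have "vs2.dim ((\<lambda>v. B v + s2 u (A v)) ` U1) < vs1.dim U1"
      using max[of u] dimU1 by linarith
    from exists_kernel_if_dim_image_less[OF lin U1 this] show ?thesis
      by (metis add_eq_0_iff2)
  qed
  then obtain k where kU1: "\<And>u. k u \<in> U1" and k: "\<And>u. k u \<noteq> 0 \<and> B (k u) = - s2 u (A (k u))"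
    by metis
  define K where "K = vs1.span (k ` X)"
  have "K \<subseteq> U1"
    unfolding K_def using kU1 U1 by (intro vs1.span_minimal) auto
  have "\<exists>v\<in>K. v \<noteq> 0 \<and> A v = 0"
  proof (rule ccontr)
    assume no: "\<not> ?thesis"
    then have ind: "inj_on k X \<and> vs1.independent (k ` X)"
      using A B X k by (intro pencil_kernels_independent[where A = A and B = B]) (auto simp: K_def)
    then have "vs1.dim K = card X"
      by (simp add: K_def vs1.dim_eq_card_independent card_image)
    \<comment> \<open>The rank of \<open>A\<close> is less than \<open>card X\<close>, so
      \<open>card X\<close> is at least \<open>dim U1\<close>. This is where enough scalars are
      needed.\<close>
    then have "K = U1"
      using X dimU1 \<open>K \<subseteq> U1\<close> by (intro vs1.subspace_dim_equal U1) (auto simp: K_def)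
    then have "r \<in> K"
      by (auto simp: U1_def intro: vs1.span_base)
    then show False
      using no r False by blast
  qed
  then obtain v where v: "v \<in> K" "v \<noteq> 0" "A v = 0"
    by blast
  then obtain c where "v = s1 c r"
    using U1_ker \<open>K \<subseteq> U1\<close> by blast
  then have "r = s1 (inverse c) v"
    using v by auto
  then have "r \<in> K"
    using v(1) by (simp add: K_def vs1.span_scale)
  have "vs2.subspace (A ` U)"
    using U by (rule A.subspace_image)
  have "B ` K \<subseteq> vs2.span (B ` k ` X)"
    by (simp add: K_def B.span_image)
  also have "\<dots> \<subseteq> A ` U"
  proof (rule vs2.span_minimal)
    have "A (k u) \<in> A ` U" for u
      using kU1 \<open>U1 \<subseteq> U\<close> by blast
    then show "B ` k ` X \<subseteq> A ` U"
      using k \<open>vs2.subspace (A ` U)\<close> by (auto intro!: vs2.subspace_neg vs2.subspace_scale)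
  qed fact
  finally show ?thesis
    using \<open>r \<in> K\<close> by blast
qed

end

section \<open>Quotients, finite bases and dimensions in coordinates\<close>

text \<open>Plays the role of the quotient map by \<open>V\<close> without leaving the type:
  \<open>p\<close> is the identity minus a projection onto \<open>V\<close>.\<close>

lemma (in vector_space) exists_linear_with_kernel:
  assumes "subspace V"
  obtains p where "Vector_Spaces.linear scale scale p" "\<And>x. p x = 0 \<longleftrightarrow> x \<in> V"
proof -
  interpret vector_space_pair scale scale
    by unfold_locales
  obtain g where g: "range g \<subseteq> V" "Vector_Spaces.linear scale scale g" "\<forall>v\<in>V. g v = v"
    using linear_exists_left_inverse_on[OF linear_id assms] by auto
  have "x - g x = 0 \<longleftrightarrow> x \<in> V" for x
    using g(1,3) by (metis eq_iff_diff_eq_0 rangeI subsetD)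
  moreover have "Vector_Spaces.linear scale scale (\<lambda>x. x - g x)"
    by (intro linear_compose_sub linear_ident g(2))
  ultimately show ?thesis
    using that by blast
qed

lemma (in vector_space) exists_finite_basis:
  assumes "finite S" "span S = UNIV"
  obtains B where "finite_dimensional_vector_space scale B"
proof -
  obtain B where B: "B \<subseteq> S" "independent B" "S \<subseteq> span B"
    using maximal_independent_subset by blast
  then have "span B = UNIV"
    using assms(2) by (metis span_minimal subspace_span top.extremum_uniqueI)
  moreover have "finite B"
    using B(1) assms(1) by (rule finite_subset)
  ultimately have "finite_dimensional_vector_space scale B"
    using B(2) by unfold_locales
  then show ?thesis
    by (rule that)
qed

text \<open>Serves to carry finite dimension from the division ring to columns and matrices:
  \<open>e k\<close> embeds the \<open>k\<close>-th coordinate and \<open>c k\<close> reads it off,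
  so the embedded copies of \<open>S\<close> span.\<close>

lemma (in vector_space_pair) exists_finite_basis_coordinates:
  fixes c :: "'k::finite \<Rightarrow> 'c \<Rightarrow> 'b" and e :: "'k \<Rightarrow> 'b \<Rightarrow> 'c"
  assumes S: "finite S" "vs1.span S = UNIV"
    and e: "\<And>k. Vector_Spaces.linear s1 s2 (e k)"
    and c: "\<And>v. (\<Sum>k\<in>UNIV. e k (c k v)) = v"
  obtains B where "finite_dimensional_vector_space s2 B"
proof (rule vs2.exists_finite_basis)
  show "finite (\<Union>k. e k ` S)"
    using S(1) by simp
  have "e k w \<in> vs2.span (\<Union>k. e k ` S)" for k w
  proof -
    interpret e: Vector_Spaces.linear s1 s2 "e k"
      by (rule e)
    have "e k w \<in> vs2.span (e k ` S)"
      using S(2) by (simp add: e.span_image)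
    also have "\<dots> \<subseteq> vs2.span (\<Union>k. e k ` S)"
      by (intro vs2.span_mono) auto
    finally show ?thesis .
  qed
  then have "(\<Sum>k\<in>UNIV. e k (c k v)) \<in> vs2.span (\<Union>k. e k ` S)" for v
    by (intro vs2.span_sum)
  then show "vs2.span (\<Union>k. e k ` S) = UNIV"
    unfolding c by blast
qed

text \<open>Coordinates are split off one at a time: on the space for \<open>insert p J\<close>, the
  map \<open>c p\<close> has the space for \<open>J\<close> as kernel and \<open>H p\<close> as
  image. Both columns and triangular matrices are counted this way.\<close>

lemma (in finite_dimensional_vector_space_pair) dim_coordinates:
  fixes c :: "'k \<Rightarrow> 'b \<Rightarrow> 'c" and e :: "'k \<Rightarrow> 'c \<Rightarrow> 'b"
  assumes c: "\<And>k. Vector_Spaces.linear s1 s2 (c k)"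
    and e: "\<And>k l w. c k (e l w) = (if k = l then w else 0)"
    and inj: "\<And>v. (\<And>k. c k v = 0) \<Longrightarrow> v = 0"
    and H: "\<And>k. vs2.subspace (H k)"
    and "finite J"
  shows "vs1.dim {v. (\<forall>k\<in>J. c k v \<in> H k) \<and> (\<forall>k. k \<notin> J \<longrightarrow> c k v = 0)} =
    (\<Sum>k\<in>J. vs2.dim (H k))"
  using \<open>finite J\<close>
proof (induction J)
  case empty
  have "{v. (\<forall>k\<in>{}. c k v \<in> H k) \<and> (\<forall>k. k \<notin> {} \<longrightarrow> c k v = 0)} \<subseteq> {0}"
    using inj by auto
  then show ?case
    by (subst sum.empty) (rule vs1.dim_eq_0[THEN iffD2])
next
  case (insert p J)
  let ?K = "\<lambda>J. {v. (\<forall>k\<in>J. c k v \<in> H k) \<and> (\<forall>k. k \<notin> J \<longrightarrow> c k v = 0)}"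
  have "vs1.subspace (?K (insert p J))"
  proof -
    have "c k (v + w) = c k v + c k w" "c k (s1 a v) = s2 a (c k v)" "c k 0 = 0" for k v w a
    proof -
      interpret ck: Vector_Spaces.linear s1 s2 "c k"
        by (rule c)
      show "c k (v + w) = c k v + c k w" "c k (s1 a v) = s2 a (c k v)" "c k 0 = 0"
        by (rule ck.add ck.scale ck.zero)+
    qed
    then show ?thesis
      using H by (simp add: vs1.subspace_def vs2.subspace_def)
  qed
  from dim_kernel_image[OF c this, of p]
  have "vs1.dim (?K (insert p J)) =
      vs1.dim {v \<in> ?K (insert p J). c p v = 0} + vs2.dim (c p ` ?K (insert p J))" .
  moreover have "{v \<in> ?K (insert p J). c p v = 0} = ?K J"
    using insert.hyps H vs2.subspace_0 by (auto split: if_splits) metis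
  moreover have "c p ` ?K (insert p J) = H p"
  proof -
    have "c p (e p w) = w \<and> e p w \<in> ?K (insert p J)" if "w \<in> H p" for w
      using that H vs2.subspace_0 by (auto simp: e)
    then show ?thesis
      by (auto simp: image_iff) metis
  qed
  ultimately show ?case
    using insert.IH insert.hyps by simp
qed

section \<open>Columns, rows and matrices over the division ring\<close>

definition vec_scale :: "('f::field \<Rightarrow> 'a::division_ring) \<Rightarrow> 'f \<Rightarrow> 'a^'n \<Rightarrow> 'a^'n" where
  "vec_scale \<iota> c x = (\<chi> i. \<iota> c * x $ i)"

text \<open>The product \<open>x r\<close> of a column and a row; rows share the type of
  columns.\<close>

definition outer :: "'a::times^'n \<Rightarrow> 'a^'n \<Rightarrow> 'a^'n^'n" where
  "outer x r = (\<chi> i j. x $ i * r $ j)"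

text \<open>The product \<open>r x\<close> of a row and a column. The order of the factors matters,
  since the ring need not be commutative.\<close>

definition dotp :: "'a::semiring_0^'n \<Rightarrow> 'a^'n \<Rightarrow> 'a" where
  "dotp r x = (\<Sum>i\<in>UNIV. r $ i * x $ i)"

definition vec_on :: "'n set \<Rightarrow> ('a::zero^'n) set" where
  "vec_on I = {x. \<forall>i. i \<notin> I \<longrightarrow> x $ i = 0}"

text \<open>Stands in for the square matrices of size \<open>card I\<close>: an induction on the
  size can shrink \<open>I\<close> and keep the index type.\<close>

definition mat_on :: "'n set \<Rightarrow> ('a::zero^'n^'n) set" where
  "mat_on I = {M. \<forall>i j. i \<notin> I \<or> j \<notin> I \<longrightarrow> M $ i $ j = 0}"

text \<open>
  For a set closed under scaling by \<open>F\<close>, excluding the eigenvalue \<open>-1\<close> excludes every nonzero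
  eigenvalue in \<open>F\<close>.
\<close>

definition trivial_spectrum :: "('a::ring_1^'n^'n) set \<Rightarrow> bool" where
  "trivial_spectrum V \<longleftrightarrow> (\<forall>M\<in>V. \<forall>x. M *v x = - x \<longrightarrow> x = 0)"

lemma outer_mult_vec: "outer x r *v z = (\<chi> i. x $ i * dotp r z)"
  by (simp add: outer_def dotp_def matrix_vector_mult_def sum_distrib_left mult.assoc)

context central_subfield_iso
begin

lemma vector_space_vec_scale: "vector_space (vec_scale \<iota> :: 'f \<Rightarrow> 'a^'n \<Rightarrow> 'a^'n)"
  by unfold_locales
    (simp_all add: vec_scale_def vec_eq_iff hom_add hom_mult hom_one distrib_left distrib_right
      mult.assoc)

lemma mult_left_commute_central: "x * (\<iota> c * y) = \<iota> c * (x * y)"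
  by (metis central mult.assoc)

end

text \<open>Fixing the bases also fixes the index type \<open>'n\<close>, as the sublocales below require.\<close>

locale matrix_bases = central_subfield_iso F \<iota>
  for F :: "'a::division_ring set" and \<iota> :: "'f::field \<Rightarrow> 'a" +
  fixes BD :: "'a set" and BV :: "('a^'n) set" and BM :: "('a^'n^'n) set" and d :: nat
  assumes BD: "finite_dimensional_vector_space (ring_scale \<iota>) BD"
    and BV: "finite_dimensional_vector_space (vec_scale \<iota>) BV"
    and BM: "finite_dimensional_vector_space (mat_scale \<iota>) BM"
    and d: "vector_space.dim (ring_scale \<iota>) UNIV = d"
begin

sublocale D: finite_dimensional_vector_space "ring_scale \<iota>" BD by (rule BD)
sublocale V: finite_dimensional_vector_space "vec_scale \<iota>" BV by (rule BV)
sublocale M: finite_dimensional_vector_space "mat_scale \<iota>" BM by (rule BM)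
sublocale VD: finite_dimensional_vector_space_pair "vec_scale \<iota>" BV "ring_scale \<iota>" BD ..
sublocale MD: finite_dimensional_vector_space_pair "mat_scale \<iota>" BM "ring_scale \<iota>" BD ..
sublocale MV: finite_dimensional_vector_space_pair "mat_scale \<iota>" BM "vec_scale \<iota>" BV ..
sublocale MM: finite_dimensional_vector_space_pair "mat_scale \<iota>" BM "mat_scale \<iota>" BM ..
sublocale MxD: finite_dimensional_vector_space_prod "mat_scale \<iota>" "ring_scale \<iota>" BM BD ..
sublocale VMD: finite_dimensional_vector_space_pair "vec_scale \<iota>" BV MxD.scale MxD.Basis_pair ..

lemma d_pos: "d > 0"
proof -
  have "\<not> (UNIV :: 'a set) \<subseteq> {0}"
    by (metis UNIV_I singletonD subsetD zero_neq_one)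
  then show ?thesis
    unfolding d[symmetric] by (metis D.dim_eq_0 gr0I)
qed

lemma subspace_vec_on: "V.subspace (vec_on I)"
  by (auto simp: V.subspace_def vec_on_def vec_scale_def)

lemma linear_vec_nth: "Vector_Spaces.linear (vec_scale \<iota>) (ring_scale \<iota>) (\<lambda>x. x $ i)"
  unfolding Vector_Spaces.linear_iff
  using vector_space_vec_scale vector_space_ring_scale by (simp add: vec_scale_def ring_scale_def)

lemma linear_mat_nth: "Vector_Spaces.linear (mat_scale \<iota>) (ring_scale \<iota>) (\<lambda>M. M $ i $ j)"
  unfolding Vector_Spaces.linear_iff
  using vector_space_mat_scale vector_space_ring_scale by (simp add: mat_scale_def ring_scale_def)

lemma linear_mult_vec: "Vector_Spaces.linear (mat_scale \<iota>) (vec_scale \<iota>) (\<lambda>M. M *v x)"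
  unfolding Vector_Spaces.linear_iff
  using vector_space_mat_scale vector_space_vec_scale
  by (simp add: mat_scale_def vec_scale_def matrix_vector_mult_def vec_eq_iff sum.distrib
      distrib_right mult.assoc sum_distrib_left)

lemma dim_vec_on: "V.dim (vec_on I :: ('a^'n) set) = card I * d"
proof -
  have "V.dim {v. (\<forall>k\<in>I. v $ k \<in> UNIV) \<and> (\<forall>k. k \<notin> I \<longrightarrow> v $ k = 0)} =
      (\<Sum>k\<in>I. D.dim (UNIV :: 'a set))"
    by (rule VD.dim_coordinates[where e = "\<lambda>k w. axis k w"])
      (auto simp: linear_vec_nth axis_def vec_eq_iff)
  then show ?thesis
    by (simp only: vec_on_def d sum_constant) (simp add: Collect_conj_eq)
qed

section \<open>The upper bound for spaces without nonzero eigenvalues in \<open>F\<close>\<close>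

text \<open>The conclusion expresses that \<open>\<Phi> x\<close> is injective on the rows supported
  in \<open>I\<close>. The finite set \<open>X\<close> of scalars encodes the lower bound on the
  size of the field alike for finite and infinite \<open>F\<close>.\<close>

lemma exists_transversal_vector:
  fixes V :: "('a^'n^'n) set" and I :: "'n set" and X :: "'f set"
  assumes V: "M.subspace V" "trivial_spectrum V" and "I \<noteq> {}"
    and X: "finite X" "card I * d \<le> card X"
  shows "\<exists>x\<in>vec_on I. x \<noteq> 0 \<and> (\<forall>r\<in>vec_on I. dotp r x = 0 \<and> outer x r \<in> V \<longrightarrow> r = 0)"
proof (rule ccontr)
  assume no: "\<not> ?thesis"
  let ?R = "vec_on I :: ('a^'n) set"
  obtain p :: "'a^'n^'n \<Rightarrow> 'a^'n^'n"
    where p: "Vector_Spaces.linear (mat_scale \<iota>) (mat_scale \<iota>) p"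
    and pV: "\<And>A. p A = 0 \<longleftrightarrow> A \<in> V"
    using M.exists_linear_with_kernel[OF V(1)] by blast
  interpret p: Vector_Spaces.linear "mat_scale \<iota>" "mat_scale \<iota>" p by fact
  define \<Phi> where "\<Phi> x r = (p (outer x r), dotp r x)" for x r
  have lin: "Vector_Spaces.linear (vec_scale \<iota>) MxD.scale (\<Phi> x)" for x
    unfolding Vector_Spaces.linear_iff
  proof (intro conjI allI V.vector_space_axioms MxD.p.vector_space_axioms)
    fix r s :: "'a^'n" and c
    have "outer x (r + s) = outer x r + outer x s"
      by (simp add: outer_def vec_eq_iff distrib_left)
    moreover have "outer x (vec_scale \<iota> c r) = mat_scale \<iota> c (outer x r)"
      by (simp add: outer_def vec_eq_iff vec_scale_def mat_scale_def mult_left_commute_central)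
    moreover have "dotp (r + s) x = dotp r x + dotp s x"
      by (simp add: dotp_def distrib_right sum.distrib)
    moreover have "dotp (vec_scale \<iota> c r) x = ring_scale \<iota> c (dotp r x)"
      by (simp add: dotp_def vec_scale_def ring_scale_def mult.assoc sum_distrib_left)
    ultimately show "\<Phi> x (r + s) = \<Phi> x r + \<Phi> x s"
      "\<Phi> x (vec_scale \<iota> c r) = MxD.scale c (\<Phi> x r)"
      by (simp_all add: \<Phi>_def MxD.scale_def p.add p.scale)
  qed
  \<comment> \<open>\<Phi> is linear in the column as well, so moving \<open>y\<close> along
    \<open>x\<close> runs through the pencil to which \<open>pencil_maximal_rank\<close>
    applies.\<close>
  have pencil: "\<Phi> (y + vec_scale \<iota> u x) r = \<Phi> y r + MxD.scale u (\<Phi> x r)" for x y u r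
  proof -
    have "outer (y + vec_scale \<iota> u x) r = outer y r + mat_scale \<iota> u (outer x r)"
      by (simp add: outer_def vec_eq_iff vec_scale_def mat_scale_def distrib_right mult.assoc)
    moreover have "dotp r (y + vec_scale \<iota> u x) = dotp r y + ring_scale \<iota> u (dotp r x)"
      by (simp add: dotp_def vec_scale_def ring_scale_def distrib_left sum.distrib
          mult_left_commute_central sum_distrib_left)
    ultimately show ?thesis
      by (simp add: \<Phi>_def MxD.scale_def p.add p.scale)
  qed
  \<comment> \<open>The negated claim only concerns nonzero \<open>x\<close>. For
    \<open>x = 0\<close> the map \<open>\<Phi> x\<close> vanishes, and a unit row at an index of
    \<open>I\<close> serves.\<close>
  have ker: "\<exists>r\<in>?R. r \<noteq> 0 \<and> \<Phi> x r = 0" if "x \<in> ?R" for x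
  proof (cases "x = 0")
    case True
    obtain i where "i \<in> I"
      using \<open>I \<noteq> {}\<close> by blast
    then have "axis i 1 \<in> ?R" "axis i 1 \<noteq> (0 :: 'a^'n)"
      by (auto simp: vec_on_def axis_def vec_eq_iff)
    moreover have "\<Phi> x r = 0" for r
    proof -
      have "outer x r = 0"
        by (simp add: True outer_def vec_eq_iff)
      then show ?thesis
        by (simp add: \<Phi>_def True dotp_def zero_prod_def p.zero)
    qed
    ultimately show ?thesis
      by blast
  next
    case False
    then show ?thesis
      using no that \<open>x \<in> ?R\<close> by (auto simp: \<Phi>_def pV zero_prod_def)
  qed
  \<comment> \<open>The kernel costs at least one dimension, hence the strict inequality. It also
    bounds the ranks, so that a maximal one exists.\<close>
  have rank: "MxD.p.dim (\<Phi> x ` ?R) < card X" if x: "x \<in> ?R" for x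
  proof -
    have "\<not> {r \<in> ?R. \<Phi> x r = 0} \<subseteq> {0}"
      using ker[OF x] by blast
    then have "V.dim {r \<in> ?R. \<Phi> x r = 0} \<noteq> 0"
      by (metis V.dim_eq_0)
    then show ?thesis
      using VMD.dim_kernel_image[OF lin[of x] subspace_vec_on[of I]] X(2)
      unfolding dim_vec_on by linarith
  qed
  have "0 \<in> ?R"
    by (simp add: vec_on_def)
  then obtain x where x: "x \<in> ?R"
    and max: "\<And>y. y \<in> ?R \<Longrightarrow> MxD.p.dim (\<Phi> y ` ?R) \<le> MxD.p.dim (\<Phi> x ` ?R)"
    using arg_max_nat_lemma[where P = "\<lambda>x. x \<in> ?R" and k = 0 and b = "card X"
        and f = "\<lambda>x. MxD.p.dim (\<Phi> x ` ?R)"] rank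
    by blast
  obtain r where r: "r \<in> ?R" "r \<noteq> 0" "\<Phi> x r = 0"
    using ker[OF x] by blast
  then obtain i where i: "r $ i \<noteq> 0"
    by (auto simp: vec_eq_iff)
  \<comment> \<open>Chosen so that \<open>r y = 1\<close>; \<open>i\<close> lies in \<open>I\<close>
    because \<open>r\<close> vanishes outside \<open>I\<close>.\<close>
  define y :: "'a^'n" where "y = axis i (inverse (r $ i))"
  have y: "y \<in> ?R"
    using i r(1) by (auto simp: y_def vec_on_def axis_def)
  have ry: "dotp r y = 1"
    using i by (simp add: dotp_def y_def axis_def if_distrib[of "(*) _"] cong: if_cong)
  have "\<Phi> y r \<in> \<Phi> x ` ?R"
  proof (rule VMD.pencil_maximal_rank[OF lin lin subspace_vec_on _ X(1) rank[OF x] r(1,3)])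
    fix u
    have "y + vec_scale \<iota> u x \<in> ?R"
      using x y subspace_vec_on by (intro V.subspace_add V.subspace_scale)
    from max[OF this] show "MxD.p.dim ((\<lambda>v. \<Phi> y v + MxD.scale u (\<Phi> x v)) ` ?R)
        \<le> MxD.p.dim (\<Phi> x ` ?R)"
      by (simp only: pencil[symmetric])
  qed
  then obtain s where "\<Phi> y r = \<Phi> x s"
    by blast
  then have sx: "dotp s x = 1" and "p (outer y r - outer x s) = 0"
    using ry by (auto simp: \<Phi>_def p.diff)
  then have "outer y r - outer x s \<in> V"
    using pV by blast
  \<comment> \<open>The product is \<open>y (r x) - x (s x)\<close>, where \<open>r x = 0\<close>
    because \<open>\<Phi> x r = 0\<close>.\<close>
  moreover have "(outer y r - outer x s) *v x = - x"
    using r(3) sx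
    by (simp add: matrix_vector_mult_diff_rdistrib outer_mult_vec \<Phi>_def zero_prod_def vec_eq_iff)
  ultimately have "x = 0"
    using V(2) unfolding trivial_spectrum_def by blast
  then show False
    using sx by (simp add: dotp_def)
qed

text \<open>For a transversal \<open>x\<close>, the map sending \<open>A\<close> to
  \<open>A x\<close> has rank less than \<open>card I * d\<close> on \<open>V\<close>, and \<Psi>
  embeds its kernel \<open>W\<close> into a space of the same kind on \<open>I - {i}\<close>. The
  bound on \<open>card X\<close> refers to \<open>'n\<close>, so it serves every smaller
  \<open>I\<close>.\<close>

lemma dim_trivial_spectrum_mat_on_le:
  fixes X :: "'f set"
  assumes X: "finite X" "CARD('n) * d \<le> card X"
  shows "M.subspace V \<Longrightarrow> trivial_spectrum V \<Longrightarrow> V \<subseteq> (mat_on I :: ('a^'n^'n) set) \<Longrightarrow>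
    M.dim V \<le> card I * (d - 1) + d * (card I choose 2)"
proof (induction "card I" arbitrary: I V)
  case 0
  then have "V \<subseteq> {0}"
    by (auto simp: mat_on_def vec_eq_iff)
  then have "M.dim V = 0"
    by (rule M.dim_eq_0[THEN iffD2])
  then show ?case
    by (rule eq_imp_le[THEN order_trans]) simp
next
  case (Suc m)
  have cardI: "card I = Suc m"
    using Suc.hyps(2) by simp
  then have "I \<noteq> {}"
    by auto
  have "card I \<le> CARD('n)"
    by (rule card_mono) auto
  then have "card I * d \<le> card X"
    using X(2) by (meson le_trans mult_le_mono1)
  from exists_transversal_vector[OF Suc.prems(1,2) \<open>I \<noteq> {}\<close> X(1) this]
  obtain x where x: "x \<in> vec_on I" "x \<noteq> 0"
    and good: "\<And>r. r \<in> vec_on I \<Longrightarrow> dotp r x = 0 \<Longrightarrow> outer x r \<in> V \<Longrightarrow> r = 0"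
    by blast
  obtain i where i: "x $ i \<noteq> 0"
    using x(2) by (auto simp: vec_eq_iff)
  then have "i \<in> I"
    using x(1) by (auto simp: vec_on_def)
  define W where "W = {A \<in> V. A *v x = 0}"
  have W: "M.subspace W"
  proof -
    interpret l: Vector_Spaces.linear "mat_scale \<iota>" "vec_scale \<iota>" "\<lambda>A. A *v x"
      by (rule linear_mult_vec)
    show ?thesis
      using Suc.prems(1) by (simp add: W_def M.subspace_def l.add l.scale)
  qed
  have dimVx: "V.dim ((\<lambda>A. A *v x) ` V) < Suc m * d"
  proof -
    interpret l: Vector_Spaces.linear "mat_scale \<iota>" "vec_scale \<iota>" "\<lambda>A. A *v x"
      by (rule linear_mult_vec)
    let ?Vx = "(\<lambda>A. A *v x) ` V"
    have Vx: "V.subspace ?Vx"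
      using Suc.prems(1) by (rule l.subspace_image)
    have "A *v x \<noteq> x" if "A \<in> V" for A
    proof
      \<comment> \<open>\<open>trivial_spectrum\<close> mentions only the eigenvalue -1; passing to
        \<open>- A\<close> excludes 1.\<close>
      assume "A *v x = x"
      then have "(- A) *v x = - x"
        by (simp add: l.neg)
      moreover have "- A \<in> V"
        using that Suc.prems(1) by (rule M.subspace_neg[rotated])
      ultimately show False
        using Suc.prems(2) x(2) by (auto simp: trivial_spectrum_def)
    qed
    then have "x \<notin> ?Vx"
      by (metis imageE)
    moreover have "?Vx \<subseteq> vec_on I"
      using Suc.prems(3) by (auto simp: mat_on_def vec_on_def matrix_vector_mult_def subset_iff)
    ultimately have "?Vx \<subset> vec_on I"
      using x(1) by blast
    then have "V.dim ?Vx < V.dim (vec_on I :: ('a^'n) set)"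
      by (intro V.dim_psubset) (simp add: V.span_eq_iff[THEN iffD2] Vx subspace_vec_on)
    then show ?thesis
      by (simp add: dim_vec_on cardI)
  qed
  \<comment> \<open>\<open>\<Psi> A\<close> is the action of \<open>A\<close> on the quotient by \<open>x D\<close>, in the coordinates other than \<open>i\<close>.\<close>
  define \<Psi> :: "'a^'n^'n \<Rightarrow> 'a^'n^'n" where
    "\<Psi> A = (\<chi> j k. if k = i then 0 else A $ j $ k - x $ j * inverse (x $ i) * A $ i $ k)" for A
  have \<Psi>: "Vector_Spaces.linear (mat_scale \<iota>) (mat_scale \<iota>) \<Psi>"
    unfolding Vector_Spaces.linear_iff using vector_space_mat_scale
    by (simp add: \<Psi>_def mat_scale_def vec_eq_iff distrib_left right_diff_distrib
        mult_left_commute_central)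
  interpret \<Psi>: Vector_Spaces.linear "mat_scale \<iota>" "mat_scale \<iota>" \<Psi> by (rule \<Psi>)
  have \<Psi>_apply: "\<Psi> A *v z = A *v z - (\<chi> j. x $ j * (inverse (x $ i) * (A *v z) $ i))"
    if "z $ i = 0" for A z
  proof -
    have "(if k = i then 0 else A $ j $ k - x $ j * inverse (x $ i) * A $ i $ k) * z $ k =
        A $ j $ k * z $ k - x $ j * (inverse (x $ i) * (A $ i $ k * z $ k))" for j k
      using that by (simp add: left_diff_distrib mult.assoc)
    then show ?thesis
      by (simp add: \<Psi>_def matrix_vector_mult_def vec_eq_iff sum_subtractf sum_distrib_left)
  qed
  \<comment> \<open>\<open>\<Psi> A = 0\<close> makes every column of \<open>A\<close> other than
    \<open>i\<close> a right multiple of \<open>x\<close>; then \<open>A x = 0\<close> gives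
    \<open>r x = 0\<close> and the same for column \<open>i\<close>. So \<open>A = x r\<close>, and
    transversality kills \<open>r\<close>.\<close>
  have \<Psi>_inj: "A = 0" if A: "A \<in> W" "\<Psi> A = 0" for A
  proof -
    define r where "r = (\<chi> k. inverse (x $ i) * A $ i $ k)"
    define E where "E = A - outer x r"
    have E: "E $ j $ k = 0" if "k \<noteq> i" for j k
    proof -
      have "E $ j $ k = \<Psi> A $ j $ k"
        using that by (simp add: E_def r_def outer_def \<Psi>_def mult.assoc)
      then show ?thesis
        by (simp add: A(2))
    qed
    have rx: "dotp r x = 0"
    proof -
      have "(A *v x) $ i = 0"
        using A(1) by (simp add: W_def)
      then have "inverse (x $ i) * (\<Sum>k\<in>UNIV. A $ i $ k * x $ k) = 0"
        by (simp add: matrix_vector_mult_def)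
      then show ?thesis
        by (simp add: dotp_def r_def sum_distrib_left mult.assoc)
    qed
    then have Ex: "E *v x = 0"
      using A(1) by (simp add: E_def W_def matrix_vector_mult_diff_rdistrib outer_mult_vec vec_eq_iff)
    have "E $ j $ i = 0" for j
    proof -
      have "(E *v x) $ j = (\<Sum>k\<in>UNIV. E $ j $ k * x $ k)"
        by (simp add: matrix_vector_mult_def)
      also have "\<dots> = (\<Sum>k\<in>UNIV. if k = i then E $ j $ i * x $ i else 0)"
        using E by (intro sum.cong refl) simp
      finally show ?thesis
        using Ex i by simp
    qed
    then have "E = 0"
      using E by (metis vec_eq_iff zero_index)
    then have "A = outer x r"
      by (simp add: E_def)
    moreover have "r \<in> vec_on I"
      using A(1) Suc.prems(3) by (auto simp: W_def r_def vec_on_def mat_on_def)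
    ultimately have "r = 0"
      using good rx A(1) by (auto simp: W_def)
    then show ?thesis
      using \<open>A = outer x r\<close> by (simp add: outer_def vec_eq_iff)
  qed
  have "M.dim (\<Psi> ` W) \<le> card (I - {i}) * (d - 1) + d * (card (I - {i}) choose 2)"
  proof (rule Suc.hyps(1))
    show "m = card (I - {i})"
      using cardI \<open>i \<in> I\<close> by simp
    show "M.subspace (\<Psi> ` W)"
      using W by (rule \<Psi>.subspace_image)
    show "\<Psi> ` W \<subseteq> mat_on (I - {i})"
    proof -
      have "\<Psi> A $ j $ k = 0" if "A \<in> V" "j \<notin> I - {i} \<or> k \<notin> I - {i}" for A j k
      proof -
        have "A $ j $ k = 0" if "j \<notin> I \<or> k \<notin> I" for j k
          using \<open>A \<in> V\<close> that Suc.prems(3) by (auto simp: mat_on_def)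
        moreover have "x $ j = 0" if "j \<notin> I"
          using that x(1) by (simp add: vec_on_def)
        ultimately show ?thesis
          using that(2) i by (auto simp: \<Psi>_def)
      qed
      then show ?thesis
        by (auto simp: mat_on_def W_def)
    qed
    show "trivial_spectrum (\<Psi> ` W)"
      unfolding trivial_spectrum_def
    proof (intro ballI allI impI)
      fix B z assume "B \<in> \<Psi> ` W" and z: "B *v z = - z"
      then obtain A where A: "A \<in> W" and B: "B = \<Psi> A"
        by blast
      have "\<Psi> A $ i $ k = 0" for k
        using i by (simp add: \<Psi>_def)
      then have "(B *v z) $ i = 0"
        by (simp add: B matrix_vector_mult_def)
      then have zi: "z $ i = 0"
        using z by simp
      \<comment> \<open>The eigenvector \<open>z\<close> of \<open>\<Psi> A\<close> lifts to
        \<open>w = z - x a\<close>, an eigenvector of \<open>A\<close> because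
        \<open>A x = 0\<close>. Once \<open>w = 0\<close>, the entry \<open>z $ i = 0\<close> forces
        \<open>a = 0\<close>.\<close>
      define a where "a = inverse (x $ i) * (A *v z) $ i"
      define w where "w = z - (\<chi> j. x $ j * a)"
      have "A *v z = - w"
        using \<Psi>_apply[OF zi, of A] z by (simp add: B w_def a_def algebra_simps)
      moreover have "A *v (\<chi> j. x $ j * a) = (\<chi> j. (A *v x) $ j * a)"
        by (simp add: matrix_vector_mult_def vec_eq_iff sum_distrib_right mult.assoc)
      ultimately have "A *v w = - w"
        using A by (simp add: w_def W_def matrix_vector_mult_diff_distrib vec_eq_iff)
      then have "w = 0"
        using A Suc.prems(2) by (auto simp: W_def trivial_spectrum_def)
      then have "z $ j = x $ j * a" for j
        by (simp add: w_def vec_eq_iff)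
      then show "z = 0"
        using zi i by (metis mult_eq_0_iff vec_eq_iff zero_index)
    qed
  qed
  moreover have "M.dim (\<Psi> ` W) = M.dim W"
  proof (rule MM.dim_image_eq[OF \<Psi>])
    show "inj_on \<Psi> (M.span W)"
      using \<Psi>_inj W \<Psi>.inj_on_iff_eq_0[of W] by (simp add: M.span_eq_iff[THEN iffD2])
  qed
  moreover have "M.dim V = M.dim W + V.dim ((\<lambda>A. A *v x) ` V)"
    unfolding W_def by (rule MV.dim_kernel_image[OF linear_mult_vec Suc.prems(1)])
  moreover have "card (I - {i}) = m"
    using cardI \<open>i \<in> I\<close> by simp
  ultimately have "M.dim V < m * (d - 1) + d * (m choose 2) + Suc m * d"
    using dimVx by simp
  \<comment> \<open>Pascal's rule accounts for \<open>d * m\<close>; the remaining \<open>d\<close>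
    is \<open>(d - 1) + 1\<close>, and the strict inequality absorbs the one.\<close>
  moreover have "m * (d - 1) + d * (m choose 2) + Suc m * d =
      Suc (Suc m * (d - 1) + d * (Suc m choose 2))"
    using d_pos by (cases d) (simp_all add: numeral_2_eq_2 algebra_simps)
  ultimately show ?case
    by (simp add: cardI)
qed

section \<open>Invertibility and the extremal example\<close>

text \<open>An injective \<open>F\<close>-linear endomorphism of the finite-dimensional column space
  is surjective; the columns of \<open>B\<close> are preimages of the unit vectors.\<close>

lemma exists_right_inverse_matrix:
  fixes A :: "'a^'n^'n"
  assumes "\<And>x. A *v x = 0 \<Longrightarrow> x = 0"
  obtains B where "A ** B = mat 1"
proof -
  have A: "Vector_Spaces.linear (vec_scale \<iota>) (vec_scale \<iota>) ((*v) A)"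
    unfolding Vector_Spaces.linear_iff using vector_space_vec_scale
    by (simp add: vec_scale_def matrix_vector_mult_def vec_eq_iff sum.distrib
        distrib_left mult_left_commute_central sum_distrib_left)
  interpret A: Vector_Spaces.linear "vec_scale \<iota>" "vec_scale \<iota>" "(*v) A" by (rule A)
  have "inj ((*v) A)"
    using assms by (simp add: A.inj_iff_eq_0)
  then have "surj ((*v) A)"
    by (rule V.linear_inj_imp_surj[OF A])
  then obtain b where b: "\<And>y. A *v b y = y"
    by (metis surjD)
  have "A ** (\<chi> i j. b (axis j 1) $ i) = mat 1"
  proof -
    have "(A ** (\<chi> i j. b (axis j 1) $ i)) $ i $ j = (A *v b (axis j 1)) $ i" for i j
      by (simp add: matrix_matrix_mult_def matrix_vector_mult_def)
    then show ?thesis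
      by (simp add: b vec_eq_iff mat_def axis_def)
  qed
  then show ?thesis
    by (rule that)
qed

text \<open>The right inverse \<open>B\<close> has trivial kernel too, hence a right inverse
  \<open>C\<close>, and \<open>A = A (B C) = C\<close>.\<close>

lemma invertible_if_kernel_trivial:
  fixes A :: "'a^'n^'n"
  assumes "\<And>x. A *v x = 0 \<Longrightarrow> x = 0"
  shows "invertible A"
proof -
  obtain B where AB: "A ** B = mat 1"
    using exists_right_inverse_matrix[OF assms] .
  have "x = 0" if "B *v x = 0" for x
    using that AB by (metis matrix_vector_mul_assoc matrix_vector_mul_lid matrix_vector_mult_0_right)
  from exists_right_inverse_matrix[OF this]
  obtain C where BC: "B ** C = mat 1" .
  have "A = C"
    using AB BC by (metis matrix_mul_assoc matrix_mul_lid matrix_mul_rid)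
  then show ?thesis
    using AB BC unfolding invertible_def by blast
qed

text \<open>Extend \<open>{1}\<close> to a basis and span the other basis vectors.\<close>

lemma exists_hyperplane:
  obtains H where "D.subspace H" "1 \<notin> H" "D.dim H = d - 1"
proof -
  have "D.independent {1}"
    by simp
  from D.maximal_independent_subset_extend[OF subset_UNIV this]
  obtain B where B: "{1} \<subseteq> B" "D.independent B" "UNIV \<subseteq> D.span B" .
  have "D.independent (B - {1})"
    using B(2) by (rule D.independent_mono) auto
  then have "D.dim (D.span (B - {1})) = card (B - {1})"
    by (rule D.dim_span_eq_card_independent)
  also have "\<dots> = d - 1"
  proof -
    have "card B = d"
      using B d D.basis_card_eq_dim[of B UNIV] by simp
    then show ?thesis
      using B(1) D.finiteI_independent[OF B(2)] by simp
  qed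
  finally have "D.dim (D.span (B - {1})) = d - 1" .
  moreover have "1 \<notin> D.span (B - {1})"
    using B(1,2) unfolding D.dependent_def by blast
  ultimately show ?thesis
    using that D.subspace_span by blast
qed

text \<open>The index type carries no order, so "upper triangular" is meant with respect to a
  numbering \<open>f\<close> of the indices.\<close>

lemma exists_maximal_unital:
  "\<exists>S :: ('a^'n^'n) set. affine_subspace (mat_scale \<iota>) S \<and> unital S \<and>
    affine_dim (mat_scale \<iota>) S = CARD('n) * (d - 1) + d * (CARD('n) choose 2)"
proof -
  obtain H where H: "D.subspace H" "1 \<notin> H" "D.dim H = d - 1"
    by (rule exists_hyperplane)
  obtain f :: "'n \<Rightarrow> nat" where f: "bij_betw f UNIV {0..<CARD('n)}"
    using ex_bij_betw_finite_nat[OF finite] by blast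
  then have inj_f: "inj f"
    by (rule bij_betw_imp_inj_on)
  define K where "K = (\<lambda>(i, j). if f i < f j then UNIV else if i = j then H else {0})"
  define T :: "('a^'n^'n) set" where "T = {A. \<forall>i j. A $ i $ j \<in> K (i, j)}"
  have K: "D.subspace (K k)" for k
    using H(1) by (simp add: K_def split: prod.split)
  have T: "M.subspace T"
    using K unfolding T_def M.subspace_def D.subspace_def
    by (simp add: mat_scale_def ring_scale_def)
  have "M.dim T = M.dim {A. (\<forall>k\<in>UNIV. A $ fst k $ snd k \<in> K k) \<and>
      (\<forall>k. k \<notin> UNIV \<longrightarrow> A $ fst k $ snd k = 0)}"
    by (simp add: T_def)
  also have "\<dots> = (\<Sum>k\<in>UNIV. D.dim (K k))"
    by (rule MD.dim_coordinates[where
          e = "\<lambda>k w. \<chi> i j. if (i, j) = k then w else 0"])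
      (auto simp: linear_mat_nth K vec_eq_iff)
  also have "\<dots> = (\<Sum>i\<in>UNIV. \<Sum>j\<in>UNIV. D.dim (K (i, j)))"
    by (simp add: sum.cartesian_product)
  also have "\<dots> = (\<Sum>i\<in>UNIV. \<Sum>j\<in>UNIV. (if f i < f j then d else 0) + (if i = j then d - 1 else 0))"
  proof (intro sum.cong refl)
    fix i j
    have "D.dim {0} = 0"
      by (rule D.dim_eq_0[THEN iffD2]) simp
    then show "D.dim (K (i, j)) = (if f i < f j then d else 0) + (if i = j then d - 1 else 0)"
      using H(3) d by (auto simp: K_def)
  qed
  also have "\<dots> = (\<Sum>j\<in>UNIV. \<Sum>i\<in>UNIV. if f i < f j then d else 0) + CARD('n) * (d - 1)"
    by (simp add: sum.distrib sum.swap[of "\<lambda>i j. if f i < f j then d else 0"])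
  \<comment> \<open>Since \<open>f\<close> counts from 0, column \<open>j\<close> has
    \<open>f j\<close> entries strictly above the diagonal.\<close>
  also have "(\<Sum>j\<in>UNIV. \<Sum>i\<in>UNIV. if f i < f j then d else 0) = (\<Sum>j\<in>UNIV. d * f j)"
  proof (intro sum.cong refl)
    fix j
    have "f ` {i. f i < f j} = {..<f j}"
    proof -
      have "f j < CARD('n)"
        using f by (auto simp: bij_betw_def)
      then have "{..<f j} \<subseteq> range f"
        using f by (auto simp: bij_betw_def)
      then show ?thesis
        by auto
    qed
    then have "card {i. f i < f j} = f j"
      using inj_f card_image[of f "{i. f i < f j}"] by (simp add: inj_on_def)
    then show "(\<Sum>i\<in>UNIV. if f i < f j then d else 0) = d * f j"
      by (simp add: sum.If_cases)
  qed
  also have "\<dots> = d * (\<Sum>k\<in>{0..<CARD('n)}. k)"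
    using sum.reindex_bij_betw[OF f, of "\<lambda>k. k"] by (simp add: sum_distrib_left[symmetric])
  also have "\<dots> = d * (CARD('n) choose 2)"
    by (simp add: Sum_Ico_nat choose_two)
  finally have dimT: "M.dim T = d * (CARD('n) choose 2) + CARD('n) * (d - 1)" .
  have "invertible (mat 1 + A)" if A: "A \<in> T" for A
  proof (rule invertible_if_kernel_trivial, rule ccontr)
    fix x assume x: "(mat 1 + A) *v x = 0" "x \<noteq> 0"
    then obtain i where "x $ i \<noteq> 0"
      by (auto simp: vec_eq_iff)
    moreover have "f j < CARD('n)" for j
      using f by (auto simp: bij_betw_def)
    \<comment> \<open>With \<open>m\<close> the last index of a nonzero entry of \<open>x\<close>,
      row \<open>m\<close> of \<open>A x\<close> reduces to the diagonal term.\<close>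
    ultimately obtain m where m: "x $ m \<noteq> 0" "\<And>j. x $ j \<noteq> 0 \<Longrightarrow> f j \<le> f m"
      using arg_max_nat_lemma[of "\<lambda>j. x $ j \<noteq> 0" i f "CARD('n)"] by blast
    have "A $ m $ j * x $ j = (if j = m then A $ m $ m * x $ m else 0)" for j
    proof (cases "f m < f j")
      case True
      then show ?thesis
        using m(2)[of j] by auto
    next
      case False
      then show ?thesis
        using A by (auto simp: T_def K_def split: if_splits)
    qed
    then have "(\<Sum>j\<in>UNIV. A $ m $ j * x $ j) =
        (\<Sum>j\<in>UNIV. if j = m then A $ m $ m * x $ m else 0)"
      by (intro sum.cong refl)
    then have "(A *v x) $ m = A $ m $ m * x $ m"
      by (simp add: matrix_vector_mult_def)
    then have "(1 + A $ m $ m) * x $ m = 0"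
      using arg_cong[OF x(1), of "\<lambda>y. y $ m"]
      by (simp add: matrix_vector_mult_add_rdistrib distrib_right)
    then have "1 = - (A $ m $ m)"
      using m(1) by (simp add: add_eq_0_iff2)
    moreover have "A $ m $ m \<in> H"
      using A by (auto simp: T_def K_def split: if_splits)
    then have "- (A $ m $ m) \<in> H"
      by (rule D.subspace_neg[OF H(1)])
    ultimately show False
      using H(2) by simp
  qed
  then show ?thesis
    using T dimT affine_dim_translate[OF T]
    by (intro exI[of _ "(\<lambda>v. mat 1 + v) ` T"]) (auto simp: affine_subspace_def unital_def)
qed

section \<open>From unital affine subspaces to linear subspaces, and the final assembly\<close>

lemma affine_dim_unital_le:
  fixes S :: "('a^'n^'n) set" and X :: "'f set"
  assumes X: "finite X" "CARD('n) * d \<le> card X"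
    and S: "affine_subspace (mat_scale \<iota>) S" "unital S"
  shows "affine_dim (mat_scale \<iota>) S \<le> CARD('n) * (d - 1) + d * (CARD('n) choose 2)"
proof -
  obtain A V where V: "M.subspace V" and S_eq: "S = (\<lambda>v. A + v) ` V"
    using S(1) unfolding affine_subspace_def by blast
  have inv: "invertible (A + v)" if "v \<in> V" for v
    using that S(2) by (auto simp: unital_def S_eq)
  \<comment> \<open>\<open>A\<close> itself lies in \<open>S\<close>, because \<open>V\<close>
    contains 0. Its inverse \<open>B\<close> turns \<open>S\<close> into
    \<open>1 + B V\<close>.\<close>
  then obtain B where B: "A ** B = mat 1" "B ** A = mat 1"
    using M.subspace_0[OF V] unfolding invertible_def by fastforce
  have lin: "Vector_Spaces.linear (mat_scale \<iota>) (mat_scale \<iota>) ((**) B)"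
    unfolding Vector_Spaces.linear_iff using vector_space_mat_scale
    by (simp add: mat_scale_def matrix_matrix_mult_def vec_eq_iff sum.distrib distrib_left
        mult_left_commute_central sum_distrib_left)
  interpret l: Vector_Spaces.linear "mat_scale \<iota>" "mat_scale \<iota>" "(**) B" by (rule lin)
  have "inj ((**) B)"
    using B by (intro inj_on_inverseI[of _ "(**) A"]) (simp add: matrix_mul_assoc)
  then have "M.dim ((**) B ` V) = M.dim V"
    using MM.dim_image_eq[OF lin inj_on_subset[OF _ subset_UNIV]] by blast
  moreover have "trivial_spectrum ((**) B ` V)"
    unfolding trivial_spectrum_def
  proof (intro ballI allI impI)
    fix C x assume "C \<in> (**) B ` V" and Cx: "C *v x = - x"
    then obtain v where v: "v \<in> V" "C = B ** v"
      by blast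
    have "v *v x = A *v (C *v x)"
      using B by (simp add: v matrix_vector_mul_assoc matrix_mul_assoc)
    also have "\<dots> = - (A *v x)"
      using matrix_vector_mult_diff_distrib[of A 0 x] by (simp add: Cx)
    finally have "(A + v) *v x = 0"
      by (simp add: matrix_vector_mult_add_rdistrib)
    then show "x = 0"
      using inv[OF v(1)] unfolding invertible_def
      by (metis matrix_vector_mul_assoc matrix_vector_mul_lid matrix_vector_mult_0_right)
  qed
  ultimately have "M.dim V \<le> CARD('n) * (d - 1) + d * (CARD('n) choose 2)"
    using dim_trivial_spectrum_mat_on_le[OF X, of "(**) B ` V" UNIV] V l.subspace_image
    by (simp add: mat_on_def)
  then show ?thesis
    by (simp add: S_eq affine_dim_translate[OF V])
qed

end

theorem theorem7p1:
  fixes F :: "'a::division_ring set"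
    and \<iota> :: "'f::field \<Rightarrow> 'a"
    and d :: nat
  assumes "central_subfield_iso F \<iota>"
    and "finite_dimension (ring_scale \<iota>) d"
    and "infinite F \<or> CARD('n::finite) * d \<le> card F"
  shows "(\<exists>S :: ('a^'n^'n) set.
            affine_subspace (mat_scale \<iota>) S \<and> unital S \<and>
            affine_dim (mat_scale \<iota>) S = CARD('n) * (d - 1) + d * (CARD('n) choose 2)) \<and>
         (\<forall>S :: ('a^'n^'n) set.
            affine_subspace (mat_scale \<iota>) S \<and> unital S \<longrightarrow>
            affine_dim (mat_scale \<iota>) S \<le> CARD('n) * (d - 1) + d * (CARD('n) choose 2))"
proof -
  interpret central_subfield_iso F \<iota> by fact
  interpret D: vector_space "ring_scale \<iota>" by (rule vector_space_ring_scale)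
  interpret V: vector_space "vec_scale \<iota> :: 'f \<Rightarrow> 'a^'n \<Rightarrow> 'a^'n" by (rule vector_space_vec_scale)
  interpret M: vector_space "mat_scale \<iota> :: 'f \<Rightarrow> 'a^'n^'n \<Rightarrow> 'a^'n^'n"
    by (rule vector_space_mat_scale)
  interpret DV: vector_space_pair "ring_scale \<iota>" "vec_scale \<iota> :: 'f \<Rightarrow> 'a^'n \<Rightarrow> 'a^'n" ..
  interpret DM: vector_space_pair "ring_scale \<iota>" "mat_scale \<iota> :: 'f \<Rightarrow> 'a^'n^'n \<Rightarrow> 'a^'n^'n" ..
  obtain B where B: "finite B" "D.span B = UNIV" and d: "D.dim UNIV = d"
    using assms(2) unfolding finite_dimension_def by blast
  obtain BD where BD: "finite_dimensional_vector_space (ring_scale \<iota>) BD"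
    using D.exists_finite_basis[OF B] .
  obtain BV :: "('a^'n) set" where BV: "finite_dimensional_vector_space (vec_scale \<iota>) BV"
  proof (rule DV.exists_finite_basis_coordinates[OF B])
    show "Vector_Spaces.linear (ring_scale \<iota>) (vec_scale \<iota>) (axis k :: 'a \<Rightarrow> 'a^'n)" for k
      unfolding Vector_Spaces.linear_iff
      using vector_space_ring_scale vector_space_vec_scale
      by (simp add: ring_scale_def vec_scale_def vec_eq_iff axis_def)
    show "(\<Sum>k\<in>UNIV. axis k (v $ k)) = v" for v :: "'a^'n"
      by (simp add: vec_eq_iff axis_def)
  qed
  obtain BM :: "('a^'n^'n) set" where BM: "finite_dimensional_vector_space (mat_scale \<iota>) BM"
  proof (rule DM.exists_finite_basis_coordinates[OF B])
    show "Vector_Spaces.linear (ring_scale \<iota>) (mat_scale \<iota>)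
        (\<lambda>w. (\<chi> i j. if (i, j) = k then w else 0) :: 'a^'n^'n)" for k
      unfolding Vector_Spaces.linear_iff
      using vector_space_ring_scale vector_space_mat_scale
      by (simp add: ring_scale_def mat_scale_def vec_eq_iff)
    show "(\<Sum>k\<in>UNIV. \<chi> i j. if (i, j) = k then v $ fst k $ snd k else 0) = v" for v :: "'a^'n^'n"
      by (simp add: vec_eq_iff)
  qed
  interpret matrix_bases F \<iota> BD BV BM d
    using BD BV BM d
    by (intro matrix_bases.intro matrix_bases_axioms.intro central_subfield_iso_axioms)
  \<comment> \<open>A finite \<open>F\<close> provides all its scalars; an infinite one, whose
    \<open>card\<close> is 0, provides a finite subset of size \<open>n d\<close>.\<close>
  obtain X :: "'f set" where X: "finite X" "CARD('n) * d \<le> card X"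
  proof (cases "finite F")
    case True
    then show ?thesis
      using that[of UNIV] assms(3) bij_betw_finite[OF bij] bij_betw_same_card[OF bij] by simp
  next
    case False
    then have "infinite (UNIV :: 'f set)"
      using bij_betw_finite[OF bij] by simp
    then show ?thesis
      using that infinite_arbitrarily_large by (metis order_refl)
  qed
  show ?thesis
    using exists_maximal_unital affine_dim_unital_le[OF X] by blast
qed

end
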